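(* Let $G$ be a finite simple $r$-regular graph, and let $\lambda\neq r$ be an eigenvalue of the adjacency matrix $A(G)$. Suppose $G$ has an eigenvector $f$ for $\lambda$ and a vertex partition $V(G)=V_1\cup V_2\cup\cdots\cup V_q$ such that each induced subgraph $G[V_i]$ is $r_1$-regular (for a common $r_1\leq r$) and $\sum_{x\in V_i}f(x)=0$ for all $i\in\{1,\ldots,q\}$. Then $$\lambda\leq \max_{1\leq i\leq q}\lambda_2(G[V_i])+\lambda_2(G_1),$$ where $G_1$ is the $(r-r_1)$-regular spanning subgraph of $G$ obtained by removing all edges in $\bigcup_{i=1}^q E(G[V_i])$.
   Context: For a graph $H$, $\lambda_1(H)\geq\lambda_2(H)\geq\cdots$ denote the eigenvalues of its adjacency matrix listed with multiplicity; $\lambda_2(H)$ is the second largest one. *)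

theory Defs
  imports
    "Graph_Theory.Digraph_Component"
    "Jordan_Normal_Form.Char_Poly"
    "HOL-Library.Disjoint_Sets"
    "HOL-Library.Extended_Real"
begin

text \<open>
  A finite simple graph is modelled by the locale \<^locale>\<open>graph\<close>: an edge $uv$ is a pair of opposite
  arcs, so degrees in the undirected sense are out-degrees.
\<close>

definition regular_graph :: "nat \<Rightarrow> ('a, 'b) pre_digraph \<Rightarrow> bool" where
  "regular_graph d H \<longleftrightarrow> (\<forall>v\<in>verts H. out_degree H v = d)"

text \<open>
  An arbitrary numbering of the vertices, used to write the adjacency matrix as an $n \times n$
  matrix. Another numbering conjugates the matrix by a permutation matrix, so the spectrum does not
  depend on the choice.
\<close>

definition vertex_list :: "('a, 'b) pre_digraph \<Rightarrow> 'a list" where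
  "vertex_list H = (SOME xs. distinct xs \<and> set xs = verts H)"

definition adjacency_matrix :: "('a, 'b) pre_digraph \<Rightarrow> real mat" where
  "adjacency_matrix H = mat (card (verts H)) (card (verts H))
     (\<lambda>(i, j). if (vertex_list H ! i) \<rightarrow>\<^bsub>H\<^esub> (vertex_list H ! j) then 1 else 0)"

definition vertex_vec :: "('a, 'b) pre_digraph \<Rightarrow> ('a \<Rightarrow> real) \<Rightarrow> real vec" where
  "vertex_vec H f = vec (card (verts H)) (\<lambda>i. f (vertex_list H ! i))"

text \<open>
  The eigenvalues with multiplicity, in non-increasing order. The adjacency matrix is real symmetric,
  so its characteristic polynomial splits over the reals and all eigenvalues occur in the list.
\<close>

definition adj_spectrum :: "('a, 'b) pre_digraph \<Rightarrow> real list" where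
  "adj_spectrum H = rev (sorted_list_of_multiset (proots (char_poly (adjacency_matrix H))))"

text \<open>
  The $k$-th largest eigenvalue, with $k$ counted from 1. A graph with fewer than $k$ vertices has
  none; it gets the value $-\infty$ and so never contributes to a maximum.
\<close>

definition adj_eigenvalue :: "nat \<Rightarrow> ('a, 'b) pre_digraph \<Rightarrow> ereal" where
  "adj_eigenvalue k H =
     (if 1 \<le> k \<and> k \<le> length (adj_spectrum H) then ereal (adj_spectrum H ! (k - 1)) else - \<infinity>)"

definition remove_induced_edges :: "('a, 'b) pre_digraph \<Rightarrow> 'a set set \<Rightarrow> ('a, 'b) pre_digraph" where
  "remove_induced_edges G P = G\<lparr>arcs := arcs G - (\<Union>W\<in>P. arcs (G \<restriction> W))\<rparr>"

lemma vertex_list: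
  assumes "finite (verts H)"
  shows "distinct (vertex_list H)" and "set (vertex_list H) = verts H"
    and "length (vertex_list H) = card (verts H)"
proof -
  have "\<exists>xs. distinct xs \<and> set xs = verts H"
    using finite_distinct_list[OF assms] by blast
  then have *: "distinct (vertex_list H) \<and> set (vertex_list H) = verts H"
    unfolding vertex_list_def by (rule someI_ex)
  then show "distinct (vertex_list H)" and "set (vertex_list H) = verts H" by auto
  from * show "length (vertex_list H) = card (verts H)"
    using distinct_card by fastforce
qed

lemma graph_subset_arcs:
  assumes "graph G"
    and "verts H \<subseteq> verts G" "arcs H \<subseteq> arcs G" "tail H = tail G" "head H = head G"
    and "\<And>e. e \<in> arcs H \<Longrightarrow> tail G e \<in> verts H \<and> head G e \<in> verts H"
    and "\<And>e e'. e \<in> arcs H \<Longrightarrow> e' \<in> arcs G \<Longrightarrow> tail G e' = head G e \<Longrightarrow> head G e' = tail G e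
           \<Longrightarrow> e' \<in> arcs H"
  shows "graph H"
proof -
  interpret graph G by fact
  have sym: "symmetric H"
    unfolding symmetric_def
  proof (rule symI)
    fix u v assume "(u, v) \<in> arcs_ends H"
    then obtain e where e: "e \<in> arcs H" "u = tail G e" "v = head G e"
      using assms(4,5) by (auto simp: arcs_ends_def arc_to_ends_def)
    then have "(u, v) \<in> arcs_ends G"
      using assms(3) by (auto simp: arcs_ends_def arc_to_ends_def)
    then have "(v, u) \<in> arcs_ends G" using sym_arcs unfolding symmetric_def by (rule symD[rotated])
    then obtain e' where e': "e' \<in> arcs G" "v = tail G e'" "u = head G e'"
      by (auto simp: arcs_ends_def arc_to_ends_def)
    then have "e' \<in> arcs H" using assms(7) e by metis
    then show "(v, u) \<in> arcs_ends H"
      using e' assms(4,5) by (force simp: arcs_ends_def arc_to_ends_def)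
  qed
  show ?thesis
  proof unfold_locales
    show "e1 = e2" if "e1 \<in> arcs H" "e2 \<in> arcs H" "arc_to_ends H e1 = arc_to_ends H e2" for e1 e2
      using that assms(3,4,5) no_multi_arcs[of e1 e2] by (auto simp: arc_to_ends_def)
    show "tail H e \<in> verts H" "head H e \<in> verts H" "tail H e \<noteq> head H e" if "e \<in> arcs H" for e
      using that assms(3-6) no_loops[of e] by auto
    show "finite (verts H)" by (rule finite_subset[OF assms(2) finite_verts])
    show "finite (arcs H)" by (rule finite_subset[OF assms(3) finite_arcs])
    show "symmetric H" by (rule sym)
  qed
qed

lemma graph_induce_subgraph:
  assumes "graph G" and "W \<subseteq> verts G"
  shows "graph (G \<restriction> W)"
  using assms(2) by (intro graph_subset_arcs[OF assms(1)]) simp_all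

lemma graph_remove_induced_edges:
  assumes "graph G"
  shows "graph (remove_induced_edges G P)"
proof -
  interpret graph G by fact
  show ?thesis
    by (rule graph_subset_arcs[OF assms]) (auto simp: remove_induced_edges_def)
qed

lemma spanning_remove_induced_edges:
  assumes "graph G"
  shows "spanning (remove_induced_edges G P) G"
proof -
  interpret graph G by fact
  interpret R: graph "remove_induced_edges G P" by (rule graph_remove_induced_edges[OF assms])
  show ?thesis
    using wf_digraph R.wf_digraph
    by (auto simp: spanning_def subgraph_def compatible_def remove_induced_edges_def)
qed

lemma regular_remove_induced_edges:
  assumes "graph G" and "regular_graph r G" and P: "partition_on (verts G) P"
    and ind: "\<And>W. W \<in> P \<Longrightarrow> regular_graph r1 (G \<restriction> W)"
  shows "regular_graph (r - r1) (remove_induced_edges G P)"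
  unfolding regular_graph_def
proof
  interpret graph G by fact
  fix v assume "v \<in> verts (remove_induced_edges G P)"
  then have v: "v \<in> verts G" by (simp add: remove_induced_edges_def)
  then obtain W where W: "W \<in> P" "v \<in> W" using partition_onD1[OF P] by auto
  have uniq: "W' = W" if "W' \<in> P" "v \<in> W'" for W'
    using disjointD[OF partition_onD2[OF P] that(1) W(1)] that(2) W(2) by blast
  have eq: "out_arcs (remove_induced_edges G P) v = out_arcs G v - out_arcs (G \<restriction> W) v"
  proof (intro equalityI subsetI)
    fix e assume "e \<in> out_arcs (remove_induced_edges G P) v"
    then show "e \<in> out_arcs G v - out_arcs (G \<restriction> W) v"
      using W by (auto simp: out_arcs_def remove_induced_edges_def)
  next
    fix e assume e: "e \<in> out_arcs G v - out_arcs (G \<restriction> W) v"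
    have "e \<notin> arcs (G \<restriction> W')" if "W' \<in> P" for W'
    proof
      assume "e \<in> arcs (G \<restriction> W')"
      with e have "v \<in> W'" by (auto simp: out_arcs_def)
      with that have "W' = W" by (rule uniq)
      with e \<open>e \<in> arcs (G \<restriction> W')\<close> show False by (auto simp: out_arcs_def)
    qed
    with e show "e \<in> out_arcs (remove_induced_edges G P) v"
      by (auto simp: out_arcs_def remove_induced_edges_def)
  qed
  have fin: "finite (out_arcs G v)" by (simp add: out_arcs_def)
  have sub: "out_arcs (G \<restriction> W) v \<subseteq> out_arcs G v" by (auto simp: out_arcs_def)
  have "out_degree (remove_induced_edges G P) v = out_degree G v - out_degree (G \<restriction> W) v"
    unfolding out_degree_def eq by (rule card_Diff_subset[OF finite_subset[OF sub fin] sub])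
  then show "out_degree (remove_induced_edges G P) v = r - r1"
    using assms(2) ind[OF W(1)] v W(2) by (simp add: regular_graph_def)
qed

end

theory Submission
  imports Defs "HOL-Analysis.Function_Topology"
begin

text \<open>
  Split the quadratic form of $A(G)$ at $f$ into the forms of $A(G_1)$ and of the $A(G[V_i])$. Each of
  these graphs is regular and $f$ sums to zero on its vertex set, so the corresponding form is at most
  $\lambda_2$ times the squared norm of $f$ there; on a one-vertex part $f$ vanishes.

  For the bound on a $d$-regular graph, a maximiser $h$ of the Rayleigh quotient on the functions
  with sum zero exists by compactness and is an eigenfunction, with an eigenvalue $l \le d$. Since
  $h$ is independent of the constant eigenfunction, $(x - d)(x - l)$ divides the characteristic
  polynomial (also when $l = d$), hence $l \le \lambda_2$.
\<close>

section \<open>Rayleigh quotients on functions with sum zero\<close>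

text \<open>Tychonoff's theorem: the topology of the function type is the product topology, and the
  box is a product over all indices.\<close>

lemma compact_box_fun:
  fixes S :: "'a \<Rightarrow> 'b::topological_space set"
  assumes "\<And>i. compact (S i)"
  shows "compact {f. \<forall>i. f i \<in> S i}"
proof -
  have "compactin (product_topology (\<lambda>i. euclidean) UNIV) (PiE UNIV S)"
    using assms by (simp add: compactin_PiE)
  moreover have "PiE UNIV S = {f. \<forall>i. f i \<in> S i}" by auto
  ultimately show ?thesis by (simp add: euclidean_product_topology)
qed

text \<open>The form is continuous and the unit sphere in the sum-zero functions is compact, so a
  maximiser \<open>h\<close> exists there. Both sides of the inequality are homogeneous of degree
  two, which carries the bound from the sphere to every sum-zero \<open>f\<close>.\<close>

lemma rayleigh_attained:
  fixes a :: "'a \<Rightarrow> 'a \<Rightarrow> real" and f0 :: "'a \<Rightarrow> real"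
  assumes fin: "finite V" and f0: "(\<Sum>x\<in>V. f0 x) = 0" "\<exists>x\<in>V. f0 x \<noteq> 0"
  obtains h where "(\<Sum>x\<in>V. h x) = 0" "(\<Sum>x\<in>V. (h x)\<^sup>2) = 1"
    "\<And>f. (\<Sum>x\<in>V. f x) = 0 \<Longrightarrow> (\<Sum>x\<in>V. f x * (\<Sum>y\<in>V. a x y * f y))
       \<le> (\<Sum>x\<in>V. h x * (\<Sum>y\<in>V. a x y * h y)) * (\<Sum>x\<in>V. (f x)\<^sup>2)"
proof -
  define Q where "Q f = (\<Sum>x\<in>V. f x * (\<Sum>y\<in>V. a x y * f y))" for f
  define N where "N f = (\<Sum>x\<in>V. (f x)\<^sup>2)" for f :: "'a \<Rightarrow> real"
  \<comment> \<open>The type of vertices may be infinite, so values outside \<open>V\<close> are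
    pinned to zero to obtain a compact box. The interval from -1 to 1 loses nothing, since a
    function of norm one has values in it on \<open>V\<close>.\<close>
  define B where "B = {f. \<forall>x. f x \<in> (if x \<in> V then {-1..1::real} else {0})}"
  define S where "S = B \<inter> {f. (\<Sum>x\<in>V. f x) = 0} \<inter> {f. N f = 1}"
  have "compact B" unfolding B_def by (rule compact_box_fun) auto
  moreover have "closed {f. (\<Sum>x\<in>V. f x) = (0::real)}"
    by (intro closed_Collect_eq continuous_intros continuous_on_product_coordinates)
  moreover have "closed {f. N f = 1}" unfolding N_def
    by (intro closed_Collect_eq continuous_intros continuous_on_product_coordinates)
  ultimately have "compact S" unfolding S_def by (intro compact_Int_closed)
  have contQ: "continuous_on S Q" unfolding Q_def
    by (rule continuous_on_subset[OF _ subset_UNIV], intro continuous_intros continuous_on_product_coordinates)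
  define nrm where "nrm f = (\<lambda>x. if x \<in> V then f x / sqrt (N f) else 0)" for f
  have nrm: "nrm f \<in> S" "Q (nrm f) = Q f / N f" if "(\<Sum>x\<in>V. f x) = 0" "N f \<noteq> 0" for f
  proof -
    have pos: "N f > 0" using that(2) sum_nonneg[of V "\<lambda>x. (f x)\<^sup>2"] unfolding N_def by auto
    have "(f x)\<^sup>2 \<le> N f" if "x \<in> V" for x
      unfolding N_def using fin that by (intro member_le_sum) auto
    then have "\<bar>f x\<bar> \<le> sqrt (N f)" if "x \<in> V" for x
      using that by (simp add: real_le_rsqrt)
    then have "- sqrt (N f) \<le> f x \<and> f x \<le> sqrt (N f)" if "x \<in> V" for x
      using that by (meson abs_le_D1 abs_le_D2 minus_le_iff)
    then have "nrm f \<in> B"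
      using pos unfolding B_def nrm_def by (auto simp: pos_divide_le_eq pos_le_divide_eq)
    moreover have "(\<Sum>x\<in>V. nrm f x) = 0"
      unfolding nrm_def using that(1) by (simp flip: sum_divide_distrib)
    moreover have "(nrm f x)\<^sup>2 = (f x)\<^sup>2 / N f" if "x \<in> V" for x
      using that pos by (simp add: nrm_def power_divide)
    then have "N (nrm f) = (\<Sum>x\<in>V. (f x)\<^sup>2 / N f)"
      unfolding N_def[of "nrm f"] by (rule sum.cong[OF refl])
    then have "N (nrm f) = N f / N f"
      by (simp only: sum_divide_distrib[symmetric]) (simp only: N_def)
    ultimately show "nrm f \<in> S" using pos by (simp add: S_def)
    have "nrm f x * (\<Sum>y\<in>V. a x y * nrm f y) = f x * (\<Sum>y\<in>V. a x y * f y) / N f"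
      if "x \<in> V" for x
    proof -
      have "(\<Sum>y\<in>V. a x y * nrm f y) = (\<Sum>y\<in>V. a x y * f y) / sqrt (N f)"
        unfolding nrm_def sum_divide_distrib by (intro sum.cong) auto
      then show ?thesis using that pos by (simp add: nrm_def)
    qed
    then show "Q (nrm f) = Q f / N f" unfolding Q_def by (simp add: sum_divide_distrib)
  qed
  have N0: "N f = 0 \<longleftrightarrow> (\<forall>x\<in>V. f x = 0)" for f
    unfolding N_def using fin by (subst sum_nonneg_eq_0_iff) auto
  \<comment> \<open>The normalised \<open>f0\<close> is the witness that the supremum is taken over
    a nonempty set.\<close>
  have "S \<noteq> {}" using nrm(1)[OF f0(1)] f0(2) N0 by blast
  then obtain h where h: "h \<in> S" "\<And>g. g \<in> S \<Longrightarrow> Q g \<le> Q h"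
    using continuous_attains_sup[OF \<open>compact S\<close> _ contQ] by blast
  show ?thesis
  proof (rule that[of h])
    show "(\<Sum>x\<in>V. h x) = 0" "(\<Sum>x\<in>V. (h x)\<^sup>2) = 1"
      using h(1) by (auto simp: S_def N_def)
    fix f :: "'a \<Rightarrow> real" assume f: "(\<Sum>x\<in>V. f x) = 0"
    have "Q f \<le> Q h * N f"
    proof (cases "N f = 0")
      case True
      then have "\<forall>x\<in>V. f x = 0" using N0 by blast
      with True show ?thesis by (simp add: Q_def)
    next
      case False
      have "N f > 0" using False sum_nonneg[of V "\<lambda>x. (f x)\<^sup>2"] unfolding N_def by auto
      then show ?thesis using h(2)[OF nrm(1)[OF f False]] nrm(2)[OF f False]
        by (simp add: field_simps)
    qed
    then show "(\<Sum>x\<in>V. f x * (\<Sum>y\<in>V. a x y * f y))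
       \<le> (\<Sum>x\<in>V. h x * (\<Sum>y\<in>V. a x y * h y)) * (\<Sum>x\<in>V. (f x)\<^sup>2)"
      by (simp add: Q_def N_def)
  qed
qed

text \<open>For small \<open>t\<close> the linear term dominates. This is the first-order condition
  at a maximiser in a form without derivatives.\<close>

lemma linear_le_quadratic_imp_nonpos:
  fixes b c :: real
  assumes "\<And>t. t > 0 \<Longrightarrow> t * b \<le> t\<^sup>2 * c"
  shows "b \<le> 0"
proof (rule ccontr)
  assume "\<not> b \<le> 0"
  \<comment> \<open>Adding 1 makes \<open>e\<close> a positive upper bound of \<open>c\<close> even
    for \<open>c = 0\<close>; then \<open>t * e = b / 2\<close> and the assumption gives
    \<open>b \<le> b / 2\<close>.\<close>
  define e where "e = \<bar>c\<bar> + 1"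
  have e: "e > 0" "c \<le> e" by (simp_all add: e_def)
  define t where "t = b / (2 * e)"
  have t: "t > 0" using \<open>\<not> b \<le> 0\<close> e(1) by (simp add: t_def)
  have "b \<le> t * c" using assms[OF t] t by (simp add: power2_eq_square)
  also have "\<dots> \<le> t * e" using t e(2) by (intro mult_left_mono) auto
  also have "\<dots> = b / 2" using e(1) by (simp add: t_def)
  finally show False using \<open>\<not> b \<le> 0\<close> by simp
qed

text \<open>Variational argument: symmetry and constant row sums make the sum-zero functions an
  invariant subspace, so the defect of the eigenvalue equation at the maximiser is itself an
  admissible direction. Moving in that direction would raise the quotient unless the defect
  vanishes.\<close>

lemma rayleigh_eigenfunction:
  fixes a :: "'a \<Rightarrow> 'a \<Rightarrow> real" and f0 :: "'a \<Rightarrow> real"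
  assumes fin: "finite V" and f0: "(\<Sum>x\<in>V. f0 x) = 0" "\<exists>x\<in>V. f0 x \<noteq> 0"
    and sym: "\<And>x y. x \<in> V \<Longrightarrow> y \<in> V \<Longrightarrow> a x y = a y x"
    and row: "\<And>x. x \<in> V \<Longrightarrow> (\<Sum>y\<in>V. a x y) = d"
  obtains m h where "(\<Sum>x\<in>V. h x) = 0" "\<exists>x\<in>V. h x \<noteq> 0"
    "\<forall>x\<in>V. (\<Sum>y\<in>V. a x y * h y) = m * h x"
    "\<forall>f. (\<Sum>x\<in>V. f x) = 0 \<longrightarrow> (\<Sum>x\<in>V. f x * (\<Sum>y\<in>V. a x y * f y)) \<le> m * (\<Sum>x\<in>V. (f x)\<^sup>2)"
proof -
  obtain h where h: "(\<Sum>x\<in>V. h x) = 0" "(\<Sum>x\<in>V. (h x)\<^sup>2) = 1"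
    and max: "\<And>f. (\<Sum>x\<in>V. f x) = 0 \<Longrightarrow> (\<Sum>x\<in>V. f x * (\<Sum>y\<in>V. a x y * f y))
       \<le> (\<Sum>x\<in>V. h x * (\<Sum>y\<in>V. a x y * h y)) * (\<Sum>x\<in>V. (f x)\<^sup>2)"
    using rayleigh_attained[OF fin f0, of a] by blast
  define L where "L f x = (\<Sum>y\<in>V. a x y * f y)" for f x
  define ip where "ip f g = (\<Sum>x\<in>V. f x * g x)" for f g :: "'a \<Rightarrow> real"
  define m where "m = ip h (L h)"
  have ip_comm: "ip f g = ip g f" for f g by (simp add: ip_def mult.commute)
  have ip_add: "ip f (\<lambda>x. p x + t * q x) = ip f p + t * ip f q" for f p q t
    by (simp add: ip_def algebra_simps sum.distrib sum_distrib_left)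
  have ip_add2: "ip (\<lambda>x. p x + t * q x) f = ip p f + t * ip q f" for f p q t
    using ip_add ip_comm by metis
  have L_add: "L (\<lambda>x. p x + t * q x) = (\<lambda>x. L p x + t * L q x)" for p q t
    by (rule ext) (simp add: L_def algebra_simps sum.distrib sum_distrib_left)
  have L_sym: "ip f (L g) = ip g (L f)" for f g
  proof -
    have "ip f (L g) = (\<Sum>x\<in>V. \<Sum>y\<in>V. f x * (a x y * g y))"
      by (simp add: ip_def L_def sum_distrib_left)
    also have "\<dots> = (\<Sum>y\<in>V. \<Sum>x\<in>V. f x * (a x y * g y))" by (rule sum.swap)
    also have "\<dots> = (\<Sum>y\<in>V. \<Sum>x\<in>V. g y * (a y x * f x))"
      using sym by (intro sum.cong) (simp_all add: mult_ac)
    also have "\<dots> = ip g (L f)" by (simp add: ip_def L_def sum_distrib_left)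
    finally show ?thesis .
  qed
  have hh: "ip h h = 1" using h(2) by (simp add: ip_def power2_eq_square)
  have max': "ip f (L f) \<le> m * ip f f" if "(\<Sum>x\<in>V. f x) = 0" for f
    using max[OF that] by (simp add: ip_def L_def m_def power2_eq_square)
  \<comment> \<open>The defect of the eigenvalue equation at \<open>h\<close>, written as a sum so
    that \<open>ip_add\<close> and \<open>L_add\<close> apply.\<close>
  define g where "g = (\<lambda>x. L h x + (- m) * h x)"
  \<comment> \<open>Symmetry moves \<open>L\<close> onto the constant function, which
    \<open>L\<close> multiplies by \<open>d\<close>.\<close>
  have "(\<Sum>x\<in>V. L h x) = ip (\<lambda>x. 1) (L h)" by (simp add: ip_def)
  also have "\<dots> = ip h (L (\<lambda>x. 1))" by (rule L_sym)
  also have "\<dots> = (\<Sum>x\<in>V. h x * d)" using row by (simp add: ip_def L_def)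
  also have "\<dots> = 0" using h(1) by (simp flip: sum_distrib_right)
  finally have Lh0: "(\<Sum>x\<in>V. L h x) = 0" .
  have g0: "(\<Sum>x\<in>V. g x) = 0"
    using Lh0 h(1) by (simp add: g_def sum_subtractf flip: sum_distrib_left)
  have hg: "ip h g = 0" by (simp add: g_def ip_add hh flip: m_def del: mult_minus_left)
  have "ip g g = ip g (\<lambda>x. L h x + (- m) * h x)" by (simp add: g_def)
  also have "\<dots> = ip g (L h)" using hg by (simp only: ip_add ip_comm[of g h])
  finally have gLh: "ip g (L h) = ip g g" by simp
  \<comment> \<open>As \<open>h\<close> and \<open>g\<close> are orthogonal, the squared norm of
    \<open>h + t g\<close> is \<open>1 + t^2 * ip g g\<close>, with no linear term, whereas the form
    at \<open>h + t g\<close> has the linear term \<open>2 * t * ip g g\<close>.\<close>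
  have "2 * ip g g \<le> 0"
  proof (rule linear_le_quadratic_imp_nonpos)
    fix t :: real assume "t > 0"
    have "(\<Sum>x\<in>V. h x + t * g x) = 0"
      using h(1) g0 by (simp add: sum.distrib flip: sum_distrib_left)
    from max'[OF this]
    have "m + t * ip g g + t * (ip g g + t * ip g (L g)) \<le> m * (1 + t * (t * ip g g))"
      by (simp only: ip_add ip_add2 L_add L_sym[of h g] gLh hh hg ip_comm[of g h] flip: m_def) 
        (simp add: algebra_simps)
    then show "t * (2 * ip g g) \<le> t\<^sup>2 * (m * ip g g - ip g (L g))"
      by (simp add: algebra_simps power2_eq_square)
  qed
  moreover have "ip g g \<ge> 0" by (simp add: ip_def sum_nonneg)
  ultimately have "ip g g = 0" by linarith
  then have gz: "\<forall>x\<in>V. g x = 0"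
    unfolding ip_def using fin by (subst (asm) sum_nonneg_eq_0_iff) auto
  show ?thesis
  proof (rule that[of h m])
    show "\<exists>x\<in>V. h x \<noteq> 0" using h(2) by (metis (no_types, lifting) sum.neutral zero_neq_one zero_power2)
    show "\<forall>x\<in>V. (\<Sum>y\<in>V. a x y * h y) = m * h x"
      using gz by (auto simp: g_def L_def)
    show "\<forall>f. (\<Sum>x\<in>V. f x) = 0 \<longrightarrow>
        (\<Sum>x\<in>V. f x * (\<Sum>y\<in>V. a x y * f y)) \<le> m * (\<Sum>x\<in>V. (f x)\<^sup>2)"
      using max' by (simp add: ip_def L_def power2_eq_square)
  qed (rule h(1))
qed

text \<open>Apply \<open>2 * f x * f y \<le> (f x)^2 + (f y)^2\<close> with nonnegative weights;
  summed by rows or by columns, each square contributes \<open>d\<close> times the squared norm.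
  This later bounds the sum-zero eigenvalue by the degree.\<close>

lemma quadratic_form_le_row_sum:
  fixes a :: "'a \<Rightarrow> 'a \<Rightarrow> real"
  assumes nn: "\<And>x y. x \<in> V \<Longrightarrow> y \<in> V \<Longrightarrow> a x y \<ge> 0"
    and sym: "\<And>x y. x \<in> V \<Longrightarrow> y \<in> V \<Longrightarrow> a x y = a y x"
    and row: "\<And>x. x \<in> V \<Longrightarrow> (\<Sum>y\<in>V. a x y) = d"
  shows "(\<Sum>x\<in>V. f x * (\<Sum>y\<in>V. a x y * f y)) \<le> d * (\<Sum>x\<in>V. (f x)\<^sup>2)"
proof -
  have *: "(\<Sum>x\<in>V. \<Sum>y\<in>V. a x y * (f x)\<^sup>2) = d * (\<Sum>x\<in>V. (f x)\<^sup>2)"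
    using row by (simp add: sum_distrib_left flip: sum_distrib_right)
  have "(\<Sum>x\<in>V. \<Sum>y\<in>V. a x y * (f y)\<^sup>2) = (\<Sum>y\<in>V. \<Sum>x\<in>V. a x y * (f y)\<^sup>2)"
    by (rule sum.swap)
  also have "\<dots> = (\<Sum>y\<in>V. \<Sum>x\<in>V. a y x * (f y)\<^sup>2)"
    using sym by (intro sum.cong) auto
  finally have **: "(\<Sum>x\<in>V. \<Sum>y\<in>V. a x y * (f y)\<^sup>2) = d * (\<Sum>x\<in>V. (f x)\<^sup>2)"
    using * by simp
  have "2 * (\<Sum>x\<in>V. f x * (\<Sum>y\<in>V. a x y * f y)) = (\<Sum>x\<in>V. \<Sum>y\<in>V. a x y * (2 * f x * f y))"
    by (simp add: sum_distrib_left mult_ac)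
  also have "\<dots> \<le> (\<Sum>x\<in>V. \<Sum>y\<in>V. a x y * (f x)\<^sup>2 + a x y * (f y)\<^sup>2)"
    unfolding distrib_left[symmetric]
    using nn by (intro sum_mono mult_left_mono sum_squares_bound) auto
  also have "\<dots> = 2 * (d * (\<Sum>x\<in>V. (f x)\<^sup>2))" by (simp add: sum.distrib * **)
  finally show ?thesis by simp
qed

section \<open>Independent eigenvectors and the multiplicity of roots\<close>

text \<open>Independence of \<open>u\<close> and \<open>v\<close> is given as a nonzero minor on
  rows \<open>i\<close> and \<open>j\<close>, so putting them into columns \<open>i\<close> and
  \<open>j\<close> of the identity matrix yields an invertible \<open>P\<close>. The case
  \<open>k = l\<close> is included and produces a double root.\<close>

lemma linear_factors_dvd_char_poly:
  fixes A :: "'a::field mat"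
  assumes A: "A \<in> carrier_mat n n" and u: "u \<in> carrier_vec n" and v: "v \<in> carrier_vec n"
    and Au: "A *\<^sub>v u = k \<cdot>\<^sub>v u" and Av: "A *\<^sub>v v = l \<cdot>\<^sub>v v"
    and i: "i < n" and j: "j < n" and indep: "u $ i * v $ j \<noteq> u $ j * v $ i"
  shows "[:- k, 1:] * [:- l, 1:] dvd char_poly A"
proof -
  have ij: "i \<noteq> j" using indep by (auto simp: mult.commute)
  define P where "P = mat n n (\<lambda>(p, q). if q = i then u $ p else if q = j then v $ p
    else if p = q then 1 else 0)"
  have P: "P \<in> carrier_mat n n" by (simp add: P_def)
  \<comment> \<open>For a kernel vector \<open>w\<close>, rows \<open>i\<close> and \<open>j\<close>
    form a two-by-two system whose determinant is the minor, so \<open>w\<close> vanishes at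
    \<open>i\<close> and \<open>j\<close> by Cramer's rule; every other row \<open>p\<close> then
    reads \<open>w $ p = 0\<close>.\<close>
  have "det P \<noteq> 0"
  proof
    assume "det P = 0"
    then obtain w where w: "w \<in> carrier_vec n" "w \<noteq> 0\<^sub>v n" "P *\<^sub>v w = 0\<^sub>v n"
      using det_0_iff_vec_prod_zero_field[OF P] by blast
    have eq: "u $ p * w $ i + v $ p * w $ j + (if p = i \<or> p = j then 0 else w $ p) = 0"
      if "p < n" for p
    proof -
      have "0 = (P *\<^sub>v w) $ p" using w that by simp
      also have "\<dots> = (\<Sum>q = 0..<n. P $$ (p, q) * w $ q)"
        using w(1) P that by (simp add: scalar_prod_def)
      also have "\<dots> = u $ p * w $ i + (v $ p * w $ j + (\<Sum>q \<in> {0..<n} - {i} - {j}. P $$ (p, q) * w $ q))"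
        using i j ij that by (simp add: sum.remove[of _ i] sum.remove[of _ j] P_def)
      also have "(\<Sum>q \<in> {0..<n} - {i} - {j}. P $$ (p, q) * w $ q)
          = (\<Sum>q \<in> {0..<n} - {i} - {j}. if q = p then w $ q else 0)"
        using that by (intro sum.cong) (auto simp: P_def)
      also have "\<dots> = (if p = i \<or> p = j then 0 else w $ p)"
        using that by (subst sum.delta) auto
      finally show ?thesis by (simp add: add.assoc)
    qed
    have e1: "u $ i * w $ i + v $ i * w $ j = 0" and e2: "u $ j * w $ i + v $ j * w $ j = 0"
      using eq[OF i] eq[OF j] by auto
    have "(u $ i * v $ j - u $ j * v $ i) * w $ i
        = v $ j * (u $ i * w $ i + v $ i * w $ j) - v $ i * (u $ j * w $ i + v $ j * w $ j)"
      by (simp add: algebra_simps)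
    then have wi: "w $ i = 0" using indep e1 e2 by simp
    have "(u $ i * v $ j - u $ j * v $ i) * w $ j
        = u $ i * (u $ j * w $ i + v $ j * w $ j) - u $ j * (u $ i * w $ i + v $ i * w $ j)"
      by (simp add: algebra_simps)
    then have wj: "w $ j = 0" using indep e1 e2 by simp
    have "w $ p = 0" if "p < n" for p
      using eq[OF that] wi wj by (auto split: if_splits)
    then have "w = 0\<^sub>v n" using w(1) by (intro eq_vecI) auto
    with w(2) show False by simp
  qed
  txt \<open>
    Columns \<open>i\<close> and \<open>j\<close> of \<open>(x I - A) P\<close> are \<open>(x - k) u\<close> and \<open>(x - l) v\<close>, so both linear factors can
    be pulled out of its determinant.
  \<close>
  define X where "X = char_poly_matrix A"
  define C where "C = map_mat (\<lambda>c. [:c:]) P"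
  define R where "R = mat n n (\<lambda>(p, q). if q = i then [:u $ p:] else if q = j then [:v $ p:]
    else (X * C) $$ (p, q))"
  define D where "D = mat n n (\<lambda>(p, q). if p = q then if q = i then [:- k, 1:]
    else if q = j then [:- l, 1:] else 1 else 0)"
  have carr: "X \<in> carrier_mat n n" "C \<in> carrier_mat n n" "R \<in> carrier_mat n n" "D \<in> carrier_mat n n"
    using A P by (auto simp: X_def C_def R_def D_def)
  \<comment> \<open>Entrywise form of \<open>(x I - A) z = (x - c) z\<close> for an eigenvector
    \<open>z\<close> with eigenvalue \<open>c\<close>; the polynomial \<open>[:0, z $ s:]\<close> is
    \<open>x\<close> times \<open>z $ s\<close>.\<close>
  have col: "(\<Sum>s = 0..<n. X $$ (p, s) * [:z $ s:]) = [:z $ p:] * [:- c, 1:]"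
    if "p < n" and z: "z \<in> carrier_vec n" "A *\<^sub>v z = c \<cdot>\<^sub>v z" for p z c
  proof -
    have "(\<Sum>s = 0..<n. X $$ (p, s) * [:z $ s:])
        = (\<Sum>s = 0..<n. (if s = p then [:0, z $ s:] else 0) - [:A $$ (p, s) * z $ s:])"
      using A that by (intro sum.cong) (auto simp: X_def char_poly_matrix_def mult.commute)
    also have "\<dots> = [:0, z $ p:] - (\<Sum>s = 0..<n. [:A $$ (p, s) * z $ s:])"
      using that by (simp add: sum_subtractf)
    also have "(\<Sum>s = 0..<n. [:A $$ (p, s) * z $ s:]) = [:\<Sum>s = 0..<n. A $$ (p, s) * z $ s:]"
      by (induction n) auto
    also have "(\<Sum>s = 0..<n. A $$ (p, s) * z $ s) = (A *\<^sub>v z) $ p"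
      using A that(1,2) by (simp add: scalar_prod_def)
    also have "\<dots> = c * z $ p" using z that(1) by simp
    finally show ?thesis by simp
  qed
  have XC: "(X * C) $$ (p, q) = (\<Sum>s = 0..<n. X $$ (p, s) * [:P $$ (s, q):])" if "p < n" "q < n" for p q
    using carr P that by (simp add: scalar_prod_def C_def)
  have RD: "(R * D) $$ (p, q) = R $$ (p, q) * D $$ (q, q)" if "p < n" "q < n" for p q
  proof -
    have "(R * D) $$ (p, q) = (\<Sum>s = 0..<n. R $$ (p, s) * D $$ (s, q))"
      using carr that by (simp add: scalar_prod_def)
    also have "\<dots> = (\<Sum>s = 0..<n. if s = q then R $$ (p, s) * D $$ (s, q) else 0)"
      using that by (intro sum.cong) (auto simp: D_def)
    also have "\<dots> = R $$ (p, q) * D $$ (q, q)" using that by simp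
    finally show ?thesis .
  qed
  have "X * C = R * D"
  proof (rule eq_matI)
    fix p q assume "p < dim_row (R * D)" "q < dim_col (R * D)"
    then have pq: "p < n" "q < n" using carr by auto
    have "(X * C) $$ (p, q) = R $$ (p, q) * D $$ (q, q)"
    proof -
      consider "q = i" | "q = j" "q \<noteq> i" | "q \<noteq> i" "q \<noteq> j" by blast
      then show ?thesis
      proof cases
        case 1
        then show ?thesis using pq i col[OF pq(1) u Au]
          by (simp only: XC) (simp add: P_def R_def D_def)
      next
        case 2
        then show ?thesis using pq j col[OF pq(1) v Av]
          by (simp only: XC) (simp add: P_def R_def D_def)
      next
        case 3
        then show ?thesis using pq by (simp add: R_def D_def)
      qed
    qed
    then show "(X * C) $$ (p, q) = (R * D) $$ (p, q)" using RD[OF pq] by simp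
  qed (use carr in auto)
  then have "det X * det C = det R * det D"
    using det_mult[OF carr(1,2)] det_mult[OF carr(3,4)] by simp
  moreover have "det C = [:det P:]"
  proof -
    interpret comm_ring_hom "\<lambda>c::'a. [:c:]" by unfold_locales auto
    show ?thesis by (simp add: C_def)
  qed
  moreover have "det D = (\<Prod>q = 0..<n. D $$ (q, q))"
    using carr(4) by (subst det_upper_triangular[of _ n]) (auto simp: D_def prod_list_diag_prod)
  moreover have "(\<Prod>q = 0..<n. D $$ (q, q)) = [:- k, 1:] * ([:- l, 1:] * (\<Prod>q \<in> {0..<n} - {i} - {j}. D $$ (q, q)))"
    using i j ij by (simp add: prod.remove[of _ i] prod.remove[of _ j] D_def)
  ultimately have "char_poly A * [:det P:]
      = [:- k, 1:] * [:- l, 1:] * (det R * (\<Prod>q \<in> {0..<n} - {i} - {j}. D $$ (q, q)))"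
    by (simp only: X_def char_poly_def mult_ac)
  \<comment> \<open>Over a field the nonzero constant \<open>det P\<close> is a unit, so it can be
    cancelled from the divisibility.\<close>
  then have "[:- k, 1:] * [:- l, 1:] dvd char_poly A * [:det P:]"
    by (simp only: dvd_triv_left)
  then have "[:- k, 1:] * [:- l, 1:] dvd Polynomial.smult (det P) (char_poly A)"
    by (simp del: mult_pCons_left)
  then show ?thesis using \<open>det P \<noteq> 0\<close> by (rule dvd_smult_cancel)
qed

text \<open>If the second entry of the non-increasing list were below \<open>c\<close>, only the
  head could reach \<open>c\<close>, yet \<open>a\<close> and \<open>b\<close> are two such entries.
  Multiset inclusion counts them twice even when they are equal; index 1 is the second
  position.\<close>

lemma two_le_rev_sorted_nth:
  fixes c :: "'a::linorder"
  assumes "{#a, b#} \<subseteq># M" "c \<le> a" "c \<le> b"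
  shows "2 \<le> length (rev (sorted_list_of_multiset M))" "c \<le> rev (sorted_list_of_multiset M) ! 1"
proof -
  define ys where "ys = rev (sorted_list_of_multiset M)"
  have M: "mset ys = M" by (simp add: ys_def)
  have "size {#a, b#} \<le> size M" using assms(1) by (rule size_mset_mono)
  then have len: "2 \<le> length ys" using M by (metis size_mset size_add_mset size_single numeral_2_eq_2 One_nat_def)
  then obtain y0 y1 zs where ys: "ys = y0 # y1 # zs"
    by (cases ys; cases "tl ys") auto
  have "sorted_wrt (\<ge>) ys" by (simp add: ys_def sorted_wrt_rev)
  then have le: "\<forall>y\<in>#mset (y1 # zs). y \<le> y1" by (simp add: ys)
  have "c \<le> y1"
  proof (rule ccontr)
    assume "\<not> c \<le> y1"
    with le have "filter_mset ((\<le>) c) (mset (y1 # zs)) = filter_mset (\<lambda>_. False) (mset (y1 # zs))"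
      by (intro filter_mset_cong) auto
    then have "filter_mset ((\<le>) c) (mset (y1 # zs)) = {#}" by simp
    then have "size (filter_mset ((\<le>) c) M) \<le> 1" by (simp add: ys flip: M)
    moreover have "filter_mset ((\<le>) c) {#a, b#} \<subseteq># filter_mset ((\<le>) c) M"
      using assms(1) by (rule multiset_filter_mono)
    then have "size (filter_mset ((\<le>) c) {#a, b#}) \<le> size (filter_mset ((\<le>) c) M)"
      by (rule size_mset_mono)
    ultimately show False using assms(2,3) by simp
  qed
  with len show "2 \<le> length (rev (sorted_list_of_multiset M))" "c \<le> rev (sorted_list_of_multiset M) ! 1"
    by (simp_all add: ys flip: ys_def)
qed

section \<open>Adjacency in vertex coordinates and the second eigenvalue\<close>

text \<open>Indexing by vertices instead of positions in \<open>vertex_list\<close> lets graphs with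
  different vertex sets, and hence different numberings, be compared.\<close>

definition adj :: "('a, 'b) pre_digraph \<Rightarrow> 'a \<Rightarrow> 'a \<Rightarrow> real" where
  "adj H x y = (if x \<rightarrow>\<^bsub>H\<^esub> y then 1 else 0)"

lemma sum_vertex_list:
  assumes "finite (verts H)"
  shows "(\<Sum>i = 0..<card (verts H). g (vertex_list H ! i)) = (\<Sum>x\<in>verts H. g x)"
proof -
  have "bij_betw ((!) (vertex_list H)) {0..<card (verts H)} (verts H)"
    using vertex_list[OF assms] by (intro bij_betw_nth) auto
  then show ?thesis by (rule sum.reindex_bij_betw)
qed

lemma vertex_vec_eq_iff:
  assumes "finite (verts H)"
  shows "vertex_vec H f = vertex_vec H g \<longleftrightarrow> (\<forall>x\<in>verts H. f x = g x)"
  using all_set_conv_all_nth[of "vertex_list H" "\<lambda>x. f x = g x"]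
  by (simp add: vertex_list[OF assms] vertex_vec_def vec_eq_iff)

lemma adjacency_matrix_mult_vertex_vec:
  assumes "finite (verts H)"
  shows "adjacency_matrix H *\<^sub>v vertex_vec H f
    = vertex_vec H (\<lambda>x. \<Sum>y\<in>verts H. adj H x y * f y)"
proof (rule eq_vecI)
  fix i assume "i < dim_vec (vertex_vec H (\<lambda>x. \<Sum>y\<in>verts H. adj H x y * f y))"
  then have "(adjacency_matrix H *\<^sub>v vertex_vec H f) $ i
    = (\<Sum>j = 0..<card (verts H). adj H (vertex_list H ! i) (vertex_list H ! j) * f (vertex_list H ! j))"
    by (simp add: adjacency_matrix_def vertex_vec_def scalar_prod_def adj_def)
  also have "\<dots> = (\<Sum>y\<in>verts H. adj H (vertex_list H ! i) y * f y)"
    by (rule sum_vertex_list[OF assms])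
  finally show "(adjacency_matrix H *\<^sub>v vertex_vec H f) $ i
      = vertex_vec H (\<lambda>x. \<Sum>y\<in>verts H. adj H x y * f y) $ i"
    using \<open>i < _\<close> by (simp add: vertex_vec_def)
qed (simp add: adjacency_matrix_def vertex_vec_def)

lemma adj_sym:
  assumes "graph H"
  shows "adj H x y = adj H y x"
proof -
  interpret graph H by fact
  show ?thesis using sym_arcs by (auto simp: adj_def symmetric_def dest: symD)
qed

text \<open>Without parallel arcs \<open>head\<close> is injective on the arcs leaving
  \<open>x\<close>, so counting neighbours counts arcs.\<close>

lemma sum_adj:
  assumes "graph H"
  shows "(\<Sum>y\<in>verts H. adj H x y) = real (out_degree H x)"
proof -
  interpret graph H by fact
  have "(\<Sum>y\<in>verts H. adj H x y) = real (card {y\<in>verts H. x \<rightarrow>\<^bsub>H\<^esub> y})"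
    by (simp add: adj_def sum.If_cases Int_def)
  also have "{y\<in>verts H. x \<rightarrow>\<^bsub>H\<^esub> y} = head H ` out_arcs H x"
    by (auto simp: arcs_ends_def arc_to_ends_def image_iff)
  also have "inj_on (head H) (out_arcs H x)"
    using no_multi_arcs by (auto simp: inj_on_def arc_to_ends_def)
  then have "card (head H ` out_arcs H x) = out_degree H x"
    by (simp add: card_image out_degree_def)
  finally show ?thesis .
qed

text \<open>Two independent eigenfunctions put two roots, counted with multiplicity, into the
  spectrum, and both are at least \<open>c\<close>. The list thus has a second entry, which excludes
  the default value minus infinity.\<close>

lemma second_eigenvalue_ge:
  assumes H: "graph H" and fin: "finite (verts H)"
    and k: "\<And>x. x \<in> verts H \<Longrightarrow> (\<Sum>y\<in>verts H. adj H x y * g y) = k * g x"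
    and l: "\<And>x. x \<in> verts H \<Longrightarrow> (\<Sum>y\<in>verts H. adj H x y * h y) = l * h x"
    and xy: "x \<in> verts H" "y \<in> verts H" "g x * h y \<noteq> g y * h x"
    and c: "c \<le> k" "c \<le> l"
  obtains m where "adj_eigenvalue 2 H = ereal m" "c \<le> m"
proof -
  let ?n = "card (verts H)"
  let ?A = "adjacency_matrix H"
  have A: "?A \<in> carrier_mat ?n ?n" by (simp add: adjacency_matrix_def)
  obtain i j where ij: "i < ?n" "j < ?n" "vertex_list H ! i = x" "vertex_list H ! j = y"
    using vertex_list[OF fin] xy(1,2) by (metis in_set_conv_nth)
  have ev: "?A *\<^sub>v vertex_vec H f = t \<cdot>\<^sub>v vertex_vec H f"
    if "\<And>x. x \<in> verts H \<Longrightarrow> (\<Sum>y\<in>verts H. adj H x y * f y) = t * f x" for f t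
  proof -
    have "?A *\<^sub>v vertex_vec H f = vertex_vec H (\<lambda>x. t * f x)"
      using that by (simp add: adjacency_matrix_mult_vertex_vec[OF fin] vertex_vec_eq_iff[OF fin])
    then show ?thesis by (auto simp: vertex_vec_def)
  qed
  have "[:- k, 1:] * [:- l, 1:] dvd char_poly ?A"
    by (rule linear_factors_dvd_char_poly[OF A _ _ ev[OF k] ev[OF l] ij(1,2)])
      (use ij xy in \<open>simp_all add: vertex_vec_def\<close>)
  then obtain p where p: "char_poly ?A = [:- k, 1:] * [:- l, 1:] * p" by (elim dvdE)
  \<comment> \<open>Root multisets add up under multiplication only for a nonzero product.\<close>
  have "char_poly ?A \<noteq> 0" using degree_monic_char_poly[OF A] by auto
  then have "proots (char_poly ?A) = {#k, l#} + proots p"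
    using p by (simp add: proots_mult del: mult_pCons_left mult_pCons_right)
  then have "{#k, l#} \<subseteq># proots (char_poly ?A)" by simp
  from two_le_rev_sorted_nth[OF this c]
  show ?thesis by (intro that[of "adj_spectrum H ! 1"]) (simp_all add: adj_eigenvalue_def adj_spectrum_def)
qed

text \<open>This is applied both to \<open>G1\<close> and to the parts. A nonzero function with sum
  zero forces at least two vertices, so the second eigenvalue is a real number.\<close>

lemma regular_graph_second_eigenvalue:
  assumes H: "graph H" and reg: "regular_graph d H"
    and f: "(\<Sum>x\<in>verts H. f x) = 0" "\<exists>x\<in>verts H. f x \<noteq> 0"
  obtains m where "adj_eigenvalue 2 H = ereal m"
    "(\<Sum>x\<in>verts H. f x * (\<Sum>y\<in>verts H. adj H x y * f y)) \<le> m * (\<Sum>x\<in>verts H. (f x)\<^sup>2)"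
proof -
  interpret graph H by fact
  note sym = adj_sym[OF H]
  have row: "(\<Sum>y\<in>verts H. adj H x y) = real d" if "x \<in> verts H" for x
    using reg that by (simp add: sum_adj[OF H] regular_graph_def)
  obtain l h where h: "(\<Sum>x\<in>verts H. h x) = 0" "\<exists>x\<in>verts H. h x \<noteq> 0"
    and l: "\<forall>x\<in>verts H. (\<Sum>y\<in>verts H. adj H x y * h y) = l * h x"
    and max: "\<forall>f. (\<Sum>x\<in>verts H. f x) = 0 \<longrightarrow>
      (\<Sum>x\<in>verts H. f x * (\<Sum>y\<in>verts H. adj H x y * f y)) \<le> l * (\<Sum>x\<in>verts H. (f x)\<^sup>2)"
    by (rule rayleigh_eigenfunction[OF finite_verts f sym row], assumption, rule that)
  have "l * (\<Sum>x\<in>verts H. (h x)\<^sup>2) = (\<Sum>x\<in>verts H. h x * (\<Sum>y\<in>verts H. adj H x y * h y))"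
    using l by (simp add: sum_distrib_left power2_eq_square mult_ac)
  also have "\<dots> \<le> real d * (\<Sum>x\<in>verts H. (h x)\<^sup>2)"
    by (rule quadratic_form_le_row_sum[OF _ sym row]) (simp_all add: adj_def)
  finally have "l \<le> real d"
  proof (rule mult_right_le_imp_le)
    obtain x where "x \<in> verts H" "h x \<noteq> 0" using h(2) by blast
    then show "0 < (\<Sum>x\<in>verts H. (h x)\<^sup>2)" by (intro sum_pos2[of _ x]) auto
  qed
  \<comment> \<open>Two vertices with different values of \<open>h\<close> give the nonzero minor
    against the constant function; a constant \<open>h\<close> with sum zero would vanish.\<close>
  have "\<exists>x\<in>verts H. \<exists>y\<in>verts H. h x \<noteq> h y"
  proof (rule ccontr)
    assume neg: "\<not> ?thesis"
    obtain x where x: "x \<in> verts H" "h x \<noteq> 0" using h(2) by blast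
    have "(\<Sum>y\<in>verts H. h y) = (\<Sum>y\<in>verts H. h x)" using neg x(1) by (intro sum.cong) blast+
    then show False using h(1) x by auto
  qed
  then obtain x y where xy: "x \<in> verts H" "y \<in> verts H" "h x \<noteq> h y" by blast
  obtain m where m: "adj_eigenvalue 2 H = ereal m" "l \<le> m"
    by (rule second_eigenvalue_ge[OF H finite_verts, of "\<lambda>_. 1" "real d" h l x y l])
      (use row l xy \<open>l \<le> real d\<close> in auto)
  have "l * (\<Sum>x\<in>verts H. (f x)\<^sup>2) \<le> m * (\<Sum>x\<in>verts H. (f x)\<^sup>2)"
    by (intro mult_right_mono m(2) sum_nonneg) simp
  with max f(1) m(1) show ?thesis by (intro that[OF m(1)]) force
qed

section \<open>Splitting the form along the vertex partition\<close>

text \<open>By disjointness \<open>W\<close> is the only part containing \<open>x\<close>, so an arc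
  leaving \<open>x\<close> is removed exactly when its head also lies in \<open>W\<close>.\<close>

lemma adj_remove_induced_edges:
  assumes disj: "disjoint P" and W: "W \<in> P" "x \<in> W"
  shows "adj G x y = adj (remove_induced_edges G P) x y + (if y \<in> W then adj (G \<restriction> W) x y else 0)"
proof -
  have uniq: "W' = W" if "W' \<in> P" "x \<in> W'" for W'
    using disjointD[OF disj that(1) W(1)] that(2) W(2) by blast
  have "(\<forall>W'\<in>P. \<not> (x \<in> W' \<and> y \<in> W')) \<longleftrightarrow> y \<notin> W" using W uniq by blast
  moreover have "x \<rightarrow>\<^bsub>remove_induced_edges G P\<^esub> y \<longleftrightarrow>
      x \<rightarrow>\<^bsub>G\<^esub> y \<and> (\<forall>W'\<in>P. \<not> (x \<in> W' \<and> y \<in> W'))"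
    by (auto simp: remove_induced_edges_def arcs_ends_def arc_to_ends_def)
  ultimately have R: "x \<rightarrow>\<^bsub>remove_induced_edges G P\<^esub> y \<longleftrightarrow> x \<rightarrow>\<^bsub>G\<^esub> y \<and> y \<notin> W" by simp
  have I: "x \<rightarrow>\<^bsub>G \<restriction> W\<^esub> y \<longleftrightarrow> x \<rightarrow>\<^bsub>G\<^esub> y \<and> y \<in> W"
    using W by (auto simp: arcs_ends_def arc_to_ends_def image_iff)
  show ?thesis by (simp add: adj_def R I)
qed

theorem theorem2p2:
  fixes G :: "('a, 'b) pre_digraph"
    and r r1 q :: nat
    and lam :: real
    and f :: "'a \<Rightarrow> real"
    and V :: "nat \<Rightarrow> 'a set"
  assumes "graph G"
    and "regular_graph r G"
    and "eigenvalue (adjacency_matrix G) lam"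
    and "lam \<noteq> real r"
    and "eigenvector (adjacency_matrix G) (vertex_vec G f) lam"
    and "\<And>i. i \<in> {1..q} \<Longrightarrow> V i \<noteq> {}"
    and "disjoint_family_on V {1..q}"
    and "(\<Union>i\<in>{1..q}. V i) = verts G"
    and "r1 \<le> r"
    and "\<And>i. i \<in> {1..q} \<Longrightarrow> regular_graph r1 (G \<restriction> V i)"
    and "\<And>i. i \<in> {1..q} \<Longrightarrow> (\<Sum>x\<in>V i. f x) = 0"
  shows "ereal lam \<le> (MAX i\<in>{1..q}. adj_eigenvalue 2 (G \<restriction> V i))
           + adj_eigenvalue 2 (remove_induced_edges G (V ` {1..q}))"
proof -
  interpret graph G by fact
  note V = assms(8)[symmetric] and zero = assms(11)
  define P where "P = V ` {1..q}"
  define G1 where "G1 = remove_induced_edges G P"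
  define N where "N W = (\<Sum>x\<in>W. (f x)\<^sup>2)" for W
  have G1: "graph G1" "verts G1 = verts G"
    using graph_remove_induced_edges[OF assms(1)] by (simp_all add: G1_def remove_induced_edges_def)
  have finV: "finite (V i)" if "i \<in> {1..q}" for i
    by (rule finite_subset[OF _ finite_verts]) (use that V in blast)
  have disj: "disjoint P" unfolding P_def by (rule disjoint_family_on_disjoint_image[OF assms(7)])
  have "partition_on (verts G) P"
    unfolding partition_on_def
  proof (intro conjI disj)
    show "\<Union>P = verts G" by (simp add: P_def V)
    show "{} \<notin> P" unfolding P_def using assms(6) by blast
  qed
  then have reg1: "regular_graph (r - r1) G1"
    unfolding G1_def using assms(1,2,10)
    by (intro regular_remove_induced_edges) (auto simp: P_def)
  have split: "(\<Sum>x\<in>verts G. g x) = (\<Sum>i\<in>{1..q}. \<Sum>x\<in>V i. g x)" for g :: "'a \<Rightarrow> real"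
    unfolding V using finV assms(7)
    by (intro sum.UNION_disjoint) (auto simp: disjoint_family_on_def)
  have f0: "(\<Sum>x\<in>verts G. f x) = 0" using zero by (simp add: split)
  have ev: "vertex_vec G f \<noteq> 0\<^sub>v (card (verts G))"
    "adjacency_matrix G *\<^sub>v vertex_vec G f = lam \<cdot>\<^sub>v vertex_vec G f"
    using assms(5) by (simp_all add: eigenvector_def adjacency_matrix_def)
  have fne: "\<exists>x\<in>verts G. f x \<noteq> 0"
  proof (rule ccontr)
    assume "\<not> ?thesis"
    then have "vertex_vec G f = vertex_vec G (\<lambda>_. 0)" by (simp add: vertex_vec_eq_iff)
    also have "\<dots> = 0\<^sub>v (card (verts G))" by (auto simp: vertex_vec_def)
    finally show False using ev(1) by simp
  qed
  have "lam \<cdot>\<^sub>v vertex_vec G f = vertex_vec G (\<lambda>x. lam * f x)" by (auto simp: vertex_vec_def)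
  then have eig: "(\<Sum>y\<in>verts G. adj G x y * f y) = lam * f x" if "x \<in> verts G" for x
    using ev(2) that by (simp add: adjacency_matrix_mult_vertex_vec vertex_vec_eq_iff)
  obtain m1 where m1: "adj_eigenvalue 2 G1 = ereal m1"
    "(\<Sum>x\<in>verts G. f x * (\<Sum>y\<in>verts G. adj G1 x y * f y)) \<le> m1 * N (verts G)"
    by (rule regular_graph_second_eigenvalue[OF G1(1) reg1, of f])
      (use f0 fne in \<open>simp_all add: G1(2) N_def\<close>)
  define M where "M = (MAX i\<in>{1..q}. adj_eigenvalue 2 (G \<restriction> V i))"
  \<comment> \<open>Restricted to parts where \<open>f\<close> does not vanish: a one-vertex part
    has second eigenvalue minus infinity, which is no real bound.\<close>
  have part: "\<exists>m. adj_eigenvalue 2 (G \<restriction> V i) = ereal m \<and>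
      (\<Sum>x\<in>V i. f x * (\<Sum>y\<in>V i. adj (G \<restriction> V i) x y * f y)) \<le> m * N (V i)"
    if "i \<in> {1..q}" "\<exists>x\<in>V i. f x \<noteq> 0" for i
  proof -
    have "graph (G \<restriction> V i)" by (rule graph_induce_subgraph[OF assms(1)]) (use V that(1) in blast)
    from regular_graph_second_eigenvalue[OF this assms(10)[OF that(1)], of f]
    show ?thesis using that zero unfolding N_def by auto
  qed
  have le_M: "adj_eigenvalue 2 (G \<restriction> V i) \<le> M" if "i \<in> {1..q}" for i
    unfolding M_def using that by (intro Max_ge) auto
  \<comment> \<open>Such a part makes the index set nonempty and bounds the maximum below by a real
    number. As the maximum is attained and no value is plus infinity, it is real, and the rest is
    real arithmetic.\<close>
  obtain i0 where i0: "i0 \<in> {1..q}" "\<exists>x\<in>V i0. f x \<noteq> 0" using fne V by blast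
  have "M \<in> (\<lambda>i. adj_eigenvalue 2 (G \<restriction> V i)) ` {1..q}"
    unfolding M_def using i0(1) by (intro Max_in) auto
  then have "M \<noteq> \<infinity>" by (auto simp: adj_eigenvalue_def split: if_splits)
  moreover have "M \<noteq> - \<infinity>" using part[OF i0] le_M[OF i0(1)] by auto
  ultimately obtain m where m: "M = ereal m" by (cases M) auto
  have partM: "(\<Sum>x\<in>V i. f x * (\<Sum>y\<in>V i. adj (G \<restriction> V i) x y * f y)) \<le> m * N (V i)"
    if i: "i \<in> {1..q}" for i
  proof (cases "\<exists>x\<in>V i. f x \<noteq> 0")
    case True
    from part[OF i this] obtain m' where m': "adj_eigenvalue 2 (G \<restriction> V i) = ereal m'"
      "(\<Sum>x\<in>V i. f x * (\<Sum>y\<in>V i. adj (G \<restriction> V i) x y * f y)) \<le> m' * N (V i)" by blast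
    have "m' \<le> m" using le_M[OF i] m m'(1) by simp
    then have "m' * N (V i) \<le> m * N (V i)"
      by (intro mult_right_mono) (auto simp: N_def sum_nonneg)
    with m'(2) show ?thesis by linarith
  qed (simp add: N_def)
  \<comment> \<open>The neighbours of \<open>x\<close> inside its own part are those in the induced
    subgraph, and all others are those in \<open>G1\<close>.\<close>
  have local: "f x * (\<Sum>y\<in>verts G. adj G x y * f y) = f x * (\<Sum>y\<in>verts G. adj G1 x y * f y)
      + f x * (\<Sum>y\<in>V i. adj (G \<restriction> V i) x y * f y)" if i: "i \<in> {1..q}" and "x \<in> V i" for i x
  proof -
    have sub: "V i \<subseteq> verts G" using V i by blast
    have "(\<Sum>y\<in>verts G. adj G x y * f y) = (\<Sum>y\<in>verts G. adj G1 x y * f y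
        + (if y \<in> V i then adj (G \<restriction> V i) x y * f y else 0))"
      using adj_remove_induced_edges[OF disj, of "V i" x G] that
      by (intro sum.cong) (auto simp: G1_def P_def algebra_simps)
    also have "\<dots> = (\<Sum>y\<in>verts G. adj G1 x y * f y) + (\<Sum>y\<in>V i. adj (G \<restriction> V i) x y * f y)"
      using sub by (simp add: sum.distrib sum.inter_restrict[symmetric] Int_absorb1)
    finally show ?thesis by (simp add: distrib_left)
  qed
  have "lam * N (verts G) = (\<Sum>x\<in>verts G. f x * (\<Sum>y\<in>verts G. adj G x y * f y))"
    using eig by (simp add: N_def sum_distrib_left power2_eq_square mult_ac)
  also have "\<dots> = (\<Sum>i\<in>{1..q}. \<Sum>x\<in>V i. f x * (\<Sum>y\<in>verts G. adj G1 x y * f y)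
      + f x * (\<Sum>y\<in>V i. adj (G \<restriction> V i) x y * f y))"
    unfolding split[of "\<lambda>x. f x * (\<Sum>y\<in>verts G. adj G x y * f y)"]
    by (intro sum.cong refl local)
  also have "\<dots> = (\<Sum>x\<in>verts G. f x * (\<Sum>y\<in>verts G. adj G1 x y * f y))
      + (\<Sum>i\<in>{1..q}. \<Sum>x\<in>V i. f x * (\<Sum>y\<in>V i. adj (G \<restriction> V i) x y * f y))"
    by (simp only: sum.distrib split[of "\<lambda>x. f x * (\<Sum>y\<in>verts G. adj G1 x y * f y)"])
  also have "\<dots> \<le> m1 * N (verts G) + (\<Sum>i\<in>{1..q}. m * N (V i))"
    by (intro add_mono m1(2) sum_mono partM)
  also have "(\<Sum>i\<in>{1..q}. m * N (V i)) = m * N (verts G)"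
    by (simp add: N_def split flip: sum_distrib_left)
  finally have "lam * N (verts G) \<le> (m + m1) * N (verts G)" by (simp add: distrib_right)
  \<comment> \<open>The squared norm is positive because \<open>f\<close> is nonzero at some vertex,
    so it can be cancelled.\<close>
  then have "lam \<le> m + m1"
  proof (rule mult_right_le_imp_le)
    obtain x where "x \<in> verts G" "f x \<noteq> 0" using fne by blast
    then show "0 < N (verts G)" unfolding N_def by (intro sum_pos2[of _ x]) auto
  qed
  then show ?thesis using m m1(1) by (simp add: M_def G1_def P_def)
qed

end
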